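(* Assume that $\bar k$ is an equilibrium point, and that the corresponding value function $V(k)$ is $C^2$ in a neighbourhood of $\bar k$. Let $\bar c=f(\bar k)$. Then the number $$\alpha:=\frac{V''(\bar k)}{u''(\bar c)}$$ must satisfy $$\alpha\ge f'(\bar k)>0 .$$ If $\alpha>f'(\bar k)$, then $$\alpha\int_0^\infty h(t)\exp\bigl[(f'(\bar k)-\alpha)t\bigr]\,dt=1 .$$
   Context: One-dimensional stationary infinite-horizon Ramsey problem ($d=1$): the decision-maker at time $t$ wants to maximise $\int_t^\infty h(s-t)u(c(s))\,ds$ subject to $\frac{dk}{ds}=f(k(s))-c(s)$. The discount function $h:[0,\infty)\to\mathbb{R}$ is continuously differentiable with $h(0)=1$, $h\ge0$, $h'\le0$, $h(t)\to0$ as $t\to\infty$. The utility $u$ is twice continuously differentiable and strictly concave, and its derivative $u'$ has a continuously differentiable inverse $i$ ($u'(c)=x\iff c=i(x)$). The production function $f$ is twice continuously differentiable, strictly concave, and satisfies the Inada conditions $f'(k)\to\infty$ as $k\to0^+$ and $f'(k)\to0$ as $k\to\infty$ (capital $k>0$). Let $\tilde u(x)=\max_c(u(c)-xc)=u(i(x))-x\,i(x)$. Stationary equilibrium strategy: a time-independent strategy $\sigma(k)=i(V'(k))$, where the value function $V(k)$ is a $C^2$ function satisfying $$V(k)=\int_0^\infty h(t)\,u\bigl(i(V'(\mathcal{K}(t,k)))\bigr)\,dt$$ or $$V'(k)f(k)+\int_0^\infty h'(t)\,u\bigl(i(V'(\mathcal{K}(t,k)))\bigr)\,dt+\tilde u(V'(k))=0,$$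 where $\mathcal{K}(t,k)$ is the value at time $t$ of the solution of $\frac{dk}{ds}=f(k(s))-\sigma(k(s))$ starting from $k$ at time $0$. Equilibrium point: $\bar k$ is an equilibrium point if there is a stationary equilibrium strategy $\sigma(k)$, defined on a neighbourhood $\Omega$ of $\bar k$, such that all trajectories of $\frac{dk}{dt}=f(k)-\sigma(k)$ starting inside $\Omega$ at $t=0$ converge to $\bar k$ as $t\to\infty$. The consumption along the constant trajectory $\bar k$ is $\bar c=\sigma(\bar k)=f(\bar k)$, and the corresponding value function is the $V$ above with $\sigma=i\circ V'$.
   Formalization: The integral identity is stated under the extra assumption u'(c̄) ≠ 0 (implied by positive marginal utility); without it the identity can fail, e.g. for u(c) = −(c−1)² with h(t) = e^{−t} and c̄ = 1. *)

theory Defs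
  imports "HOL-Analysis.Analysis"
begin

definition C2_on :: "real set \<Rightarrow> (real \<Rightarrow> real) \<Rightarrow> bool" where
  "C2_on S g \<longleftrightarrow> open S \<and> g C1_differentiable_on S \<and> deriv g C1_differentiable_on S"

definition strictly_concave_on :: "real set \<Rightarrow> (real \<Rightarrow> real) \<Rightarrow> bool" where
  "strictly_concave_on S g \<longleftrightarrow> convex S \<and>
     (\<forall>x\<in>S. \<forall>y\<in>S. \<forall>t. x \<noteq> y \<and> 0 < t \<and> t < 1 \<longrightarrow>
        (1 - t) * g x + t * g y < g ((1 - t) * x + t * y))"

text \<open>The discount function lives on the half line, so its derivative at 0 is one-sided.\<close>

definition discount_deriv :: "(real \<Rightarrow> real) \<Rightarrow> real \<Rightarrow> real" where
  "discount_deriv h t = vector_derivative h (at t within {0..})"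

definition discount_function :: "(real \<Rightarrow> real) \<Rightarrow> bool" where
  "discount_function h \<longleftrightarrow>
     (\<forall>t\<ge>0. h differentiable (at t within {0..})) \<and>
     continuous_on {0..} (discount_deriv h) \<and>
     h 0 = 1 \<and> (\<forall>t\<ge>0. h t \<ge> 0) \<and> (\<forall>t\<ge>0. discount_deriv h t \<le> 0) \<and>
     (h \<longlongrightarrow> 0) at_top"

text \<open>The set \<open>C\<close> of admissible consumption levels is any open interval, for example the whole
  line or the positive half line. Strict concavity does not exclude satiation, \<open>deriv u c = 0\<close>. The
  function \<open>i\<close> is the inverse of \<open>deriv u\<close> and is relevant on \<open>deriv u ` C\<close> only.\<close>

definition utility_function :: "real set \<Rightarrow> (real \<Rightarrow> real) \<Rightarrow> (real \<Rightarrow> real) \<Rightarrow> bool" where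
  "utility_function C u i \<longleftrightarrow>
     C \<noteq> {} \<and> C2_on C u \<and> strictly_concave_on C u \<and>
     (\<forall>c\<in>C. \<forall>x\<in>deriv u ` C. deriv u c = x \<longleftrightarrow> c = i x) \<and>
     i C1_differentiable_on (deriv u ` C)"

definition production_function :: "(real \<Rightarrow> real) \<Rightarrow> bool" where
  "production_function f \<longleftrightarrow>
     C2_on {0<..} f \<and> strictly_concave_on {0<..} f \<and>
     filterlim (deriv f) at_top (at_right 0) \<and> (deriv f \<longlongrightarrow> 0) at_top"

text \<open>For \<open>x \<in> deriv u ` C\<close> this supremum is a maximum, attained at \<open>i x\<close>; see below.\<close>

definition utility_conjugate :: "real set \<Rightarrow> (real \<Rightarrow> real) \<Rightarrow> real \<Rightarrow> real" where
  "utility_conjugate C u x = (SUP c\<in>C. u c - x * c)"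

definition trajectory ::
  "(real \<Rightarrow> real) \<Rightarrow> (real \<Rightarrow> real) \<Rightarrow> real set \<Rightarrow> real \<Rightarrow> (real \<Rightarrow> real) \<Rightarrow> bool" where
  "trajectory f \<sigma> \<Omega> k0 k \<longleftrightarrow> k 0 = k0 \<and>
     (\<forall>s\<ge>0. k s \<in> \<Omega> \<and> (k has_real_derivative f (k s) - \<sigma> (k s)) (at s within {0..}))"

definition strategy :: "(real \<Rightarrow> real) \<Rightarrow> (real \<Rightarrow> real) \<Rightarrow> real \<Rightarrow> real" where
  "strategy i V k = i (deriv V k)"

text \<open>\<open>K t k\<close> is the capital at time \<open>t\<close> starting from \<open>k\<close>. As the strategy is defined on
  \<open>\<Omega>\<close> only, trajectories have to remain in \<open>\<Omega>\<close>. The Henstock--Kurzweil integral over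
  the half line includes the convergent improper integrals.\<close>

definition integral_equation ::
  "(real \<Rightarrow> real) \<Rightarrow> (real \<Rightarrow> real) \<Rightarrow> (real \<Rightarrow> real) \<Rightarrow> (real \<Rightarrow> real) \<Rightarrow>
   (real \<Rightarrow> real \<Rightarrow> real) \<Rightarrow> real \<Rightarrow> bool" where
  "integral_equation h u i V K k \<longleftrightarrow>
     (\<lambda>t. h t * u (i (deriv V (K t k)))) integrable_on {0..} \<and>
     V k = integral {0..} (\<lambda>t. h t * u (i (deriv V (K t k))))"

definition differentiated_equation ::
  "(real \<Rightarrow> real) \<Rightarrow> real set \<Rightarrow> (real \<Rightarrow> real) \<Rightarrow> (real \<Rightarrow> real) \<Rightarrow> (real \<Rightarrow> real) \<Rightarrow>
   (real \<Rightarrow> real) \<Rightarrow> (real \<Rightarrow> real \<Rightarrow> real) \<Rightarrow> real \<Rightarrow> bool" where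
  "differentiated_equation h C u i f V K k \<longleftrightarrow>
     (\<lambda>t. discount_deriv h t * u (i (deriv V (K t k)))) integrable_on {0..} \<and>
     deriv V k * f k
       + integral {0..} (\<lambda>t. discount_deriv h t * u (i (deriv V (K t k))))
       + utility_conjugate C u (deriv V k) = 0"

definition stationary_equilibrium ::
  "(real \<Rightarrow> real) \<Rightarrow> real set \<Rightarrow> (real \<Rightarrow> real) \<Rightarrow> (real \<Rightarrow> real) \<Rightarrow> (real \<Rightarrow> real) \<Rightarrow>
   real set \<Rightarrow> (real \<Rightarrow> real) \<Rightarrow> bool" where
  "stationary_equilibrium h C u i f \<Omega> V \<longleftrightarrow>
     \<Omega> \<subseteq> {0<..} \<and> C2_on \<Omega> V \<and> deriv V ` \<Omega> \<subseteq> deriv u ` C \<and>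
     (\<exists>K. (\<forall>k\<in>\<Omega>. trajectory f (strategy i V) \<Omega> k (\<lambda>t. K t k)) \<and>
          ((\<forall>k\<in>\<Omega>. integral_equation h u i V K k) \<or>
           (\<forall>k\<in>\<Omega>. differentiated_equation h C u i f V K k)))"

text \<open>The neighbourhood \<open>\<Omega>\<close> and the corresponding value function \<open>V\<close> are kept as
  arguments because the second derivative of \<open>V\<close> at the equilibrium point is of interest.\<close>

definition equilibrium_point ::
  "(real \<Rightarrow> real) \<Rightarrow> real set \<Rightarrow> (real \<Rightarrow> real) \<Rightarrow> (real \<Rightarrow> real) \<Rightarrow> (real \<Rightarrow> real) \<Rightarrow>
   real set \<Rightarrow> (real \<Rightarrow> real) \<Rightarrow> real \<Rightarrow> bool" where
  "equilibrium_point h C u i f \<Omega> V kbar \<longleftrightarrow>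
     kbar \<in> \<Omega> \<and> stationary_equilibrium h C u i f \<Omega> V \<and>
     (\<forall>k0\<in>\<Omega>. \<forall>k. trajectory f (strategy i V) \<Omega> k0 k \<longrightarrow> (k \<longlongrightarrow> kbar) at_top)"

lemma utility_conjugate_eq:
  assumes U: "utility_function C u i" and x: "x \<in> deriv u ` C"
  shows "i x \<in> C" and "\<And>c. c \<in> C \<Longrightarrow> u c - x * c \<le> u (i x) - x * i x"
    and "utility_conjugate C u x = u (i x) - x * i x"
proof -
  from x obtain d where d: "d \<in> C" "x = deriv u d" by auto
  have "\<forall>c\<in>C. \<forall>y\<in>deriv u ` C. deriv u c = y \<longleftrightarrow> c = i y"
    using U by (simp add: utility_function_def)
  from bspec[OF bspec[OF this d(1)] x] have ix: "i x = d"
    using d(2) by simp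
  then show ixC: "i x \<in> C" using d by simp
  have C: "open C" "convex C"
    using U by (auto simp: utility_function_def C2_on_def strictly_concave_on_def)
  have D: "(u has_real_derivative deriv u z) (at z)" if "z \<in> C" for z
  proof -
    have "u C1_differentiable_on C"
      using U by (simp add: utility_function_def C2_on_def)
    then have "u differentiable (at z)"
      using that by (simp add: C1_differentiable_on_eq)
    then show ?thesis
      by (metis DERIV_deriv_iff_real_differentiable)
  qed
  have conv: "convex_on C (\<lambda>c. - u c)"
  proof (rule convex_onI)
    fix t a b :: real assume t: "0 < t" "t < 1" "a \<in> C" "b \<in> C"
    show "- u ((1 - t) *\<^sub>R a + t *\<^sub>R b) \<le> (1 - t) * - u a + t * - u b"
    proof (cases "a = b")
      case True then show ?thesis by (simp add: algebra_simps)
    next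
      case False
      then have "(1 - t) * u a + t * u b < u ((1 - t) * a + t * b)"
        using U t unfolding utility_function_def strictly_concave_on_def by blast
      then show ?thesis by simp
    qed
  qed (use C in auto)
  show max: "u c - x * c \<le> u (i x) - x * i x" if c: "c \<in> C" for c
  proof -
    have "((\<lambda>c. - u c) has_real_derivative - x) (at d within C)"
      using has_field_derivative_at_within[OF DERIV_minus[OF D[OF d(1)]]] d(2) by simp
    moreover have "d \<in> interior C" using C d by (simp add: interior_open)
    ultimately have "- u c - - u d \<ge> - x * (c - d)"
      by (rule convex_on_imp_above_tangent[OF conv convex_connected[OF C(2)] _ c, rotated])
    then show ?thesis by (simp add: ix algebra_simps)
  qed
  show "utility_conjugate C u x = u (i x) - x * i x"
    unfolding utility_conjugate_def using max ixC by (intro cSup_eq_maximum) auto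
qed

end

theory Submission
  imports Defs
begin

text \<open>
  Capital follows the autonomous equation with vector field \<open>f - \<sigma>\<close>, where \<open>\<sigma> = i \<circ> V'\<close> is the
  strategy. It vanishes at \<open>kbar\<close>, as limits of trajectories are stationary, so \<open>\<sigma> kbar = cbar\<close>; and
  since \<open>i' = 1 / (u'' \<circ> i)\<close>, the chain rule gives \<open>\<sigma>' kbar = \<alpha>\<close>. Hence the linearization at \<open>kbar\<close>
  has the rate \<open>r = f' kbar - \<alpha>\<close>. If \<open>r\<close> were positive, then the vector field would be positive just
  above \<open>kbar\<close>, and trajectories could not descend to \<open>kbar\<close> (\<open>trajectory_stays_above\<close>). So
  \<open>\<alpha> \<ge> f' kbar\<close>, and \<open>f' > 0\<close> because \<open>f'\<close> strictly decreases to \<open>0\<close>.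

  Now let \<open>r < 0\<close>. Trajectories that start slightly above \<open>kbar\<close> approach it exponentially, and the
  derivative of \<open>K t k\<close> in \<open>k\<close> at \<open>kbar\<close> from the right is \<open>exp (r * t)\<close>. This follows from barriers
  and a sandwich (\<open>trajectory_exponential_bounds\<close>, \<open>trajectory_linearization\<close>), without results on
  existence, uniqueness or smooth dependence for differential equations. Dominated convergence
  then differentiates both equations for \<open>V\<close> at \<open>kbar\<close> (\<open>flow_integral_right_derivative\<close>). As
  \<open>u' cbar = V' kbar\<close>, the integral equation gives \<open>V' = V' \<alpha> I\<close> with the integral \<open>I\<close> of
  \<open>h t * exp (r * t)\<close>. The differentiated equation gives \<open>V' f' + V' \<alpha> J = 0\<close> with the integral \<open>J\<close>
  of \<open>h' t * exp (r * t)\<close>, and \<open>J = - 1 - r I\<close> by parts, so that \<open>r (\<alpha> I - 1) = 0\<close>. In both cases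
  \<open>\<alpha> I = 1\<close> after division by \<open>V' kbar\<close>, in the second case also by \<open>r\<close>.
\<close>

section \<open>Trajectories of an autonomous scalar equation\<close>

lemma half_line_mvt:
  fixes y :: "real \<Rightarrow> real"
  assumes y: "\<And>s. s \<ge> 0 \<Longrightarrow> (y has_real_derivative D s) (at s within {0..})"
    and st: "0 \<le> s" "s < t"
  obtains z where "s < z" "z < t" "y t - y s = D z * (t - s)"
proof (rule mvt[of s t y "\<lambda>z x. D z * x"])
  show "continuous_on {s..t} y"
    using st by (intro DERIV_continuous_on[of _ _ D] has_field_derivative_subset[OF y]) auto
  show "(y has_derivative (\<lambda>x. D z * x)) (at z)" if "s < z" "z < t" for z
  proof -
    have "at z within {0..} = at z"
      using that st by (intro at_within_interior) auto
    then show ?thesis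
      using y[of z] that st by (simp add: has_field_derivative_def)
  qed
qed (use st in auto)

text \<open>A trajectory of an autonomous equation cannot move up across a level at which the
  vector field is negative. No regularity of the vector field is needed.\<close>

lemma trajectory_stays_below:
  fixes y :: "real \<Rightarrow> real"
  assumes y: "\<And>s. s \<ge> 0 \<Longrightarrow> (y has_real_derivative G (y s)) (at s within {0..})"
    and p: "y 0 \<le> p" "G p < 0" and t: "t \<ge> 0"
  shows "y t \<le> p"
proof (rule ccontr)
  assume "\<not> y t \<le> p"
  have cont: "continuous_on {0..t} y"
    by (intro DERIV_continuous_on[of _ _ "\<lambda>s. G (y s)"] has_field_derivative_subset[OF y]) auto
  \<comment> \<open>the last time before \<open>t\<close> at which the trajectory is not above \<open>p\<close>\<close>
  define S where "S = {0..t} \<inter> y -` {..p}"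
  have "compact S"
    unfolding S_def using continuous_closed_preimage[OF cont, of "{..p}"]
    by (simp add: compact_eq_bounded_closed bounded_Int)
  moreover have "0 \<in> S" using p t by (simp add: S_def)
  ultimately obtain s where s: "s \<in> S" and max: "\<And>r. r \<in> S \<Longrightarrow> r \<le> s"
    using compact_attains_sup[of S] by blast
  have s0: "0 \<le> s" "s \<le> t" "y s \<le> p" using s by (auto simp: S_def)
  have "continuous_on {s..t} y"
    using cont by (rule continuous_on_subset) (use s0 in auto)
  then obtain r where r: "s \<le> r" "r \<le> t" "y r = p"
    using IVT'[of y s p t] s0 \<open>\<not> y t \<le> p\<close> by auto
  then have "r \<in> S" using s0 by (auto simp: S_def)
  then have ys: "y s = p" using max r by force
  then have "s < t" using s0 \<open>\<not> y t \<le> p\<close> by (cases "s = t") auto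
  obtain d where d: "d > 0" "\<And>h. h > 0 \<Longrightarrow> s + h \<in> {0..} \<Longrightarrow> h < d \<Longrightarrow> y (s + h) < y s"
    using has_real_derivative_neg_dec_right[OF y[OF s0(1)]] p(2) ys by auto
  define h where "h = min (d / 2) (t - s)"
  have h: "h > 0" "h < d" "s + h \<le> t"
    using d(1) \<open>s < t\<close> by (auto simp: h_def)
  then have "s + h \<in> S"
    using d(2)[of h] s0 ys by (auto simp: S_def)
  then show False using max h by force
qed

lemma trajectory_stays_above:
  fixes y :: "real \<Rightarrow> real"
  assumes y: "\<And>s. s \<ge> 0 \<Longrightarrow> (y has_real_derivative G (y s)) (at s within {0..})"
    and p: "p \<le> y 0" "0 < G p" and t: "t \<ge> 0"
  shows "p \<le> y t"
proof -
  have "- y t \<le> - p"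
  proof (rule trajectory_stays_below[where y = "\<lambda>s. - y s" and G = "\<lambda>x. - G (- x)"])
    show "((\<lambda>s. - y s) has_real_derivative - G (- (- y s))) (at s within {0..})" if "s \<ge> 0" for s
      using DERIV_minus[OF y[OF that]] by simp
  qed (use p t in auto)
  then show ?thesis by simp
qed

lemma limit_of_trajectory_is_stationary:
  fixes y :: "real \<Rightarrow> real"
  assumes y: "\<And>s. s \<ge> 0 \<Longrightarrow> (y has_real_derivative G (y s)) (at s within {0..})"
    and lim: "(y \<longlongrightarrow> a) at_top" and G: "isCont G a"
  shows "G a = 0"
proof -
  have "\<exists>z. real n < z \<and> y (real n + 1) - y (real n) = G (y z)" for n
  proof -
    obtain z where "real n < z" "y (real n + 1) - y (real n) = G (y z) * (real n + 1 - real n)"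
      by (rule half_line_mvt[OF y, of "real n" "real n + 1"]) auto
    then show ?thesis by auto
  qed
  then obtain z where z: "\<And>n. real n < z n"
      "\<And>n. y (real n + 1) - y (real n) = G (y (z n))"
    by metis
  have "filterlim z at_top sequentially"
    by (rule filterlim_at_top_mono[OF filterlim_real_sequentially]) (simp add: z(1) less_imp_le)
  then have "(\<lambda>n. y (z n)) \<longlonglongrightarrow> a"
    by (rule filterlim_compose[OF lim])
  then have "(\<lambda>n. G (y (z n))) \<longlonglongrightarrow> G a"
    by (rule isCont_tendsto_compose[OF G])
  moreover have "(\<lambda>n. y (real n + 1) - y (real n)) \<longlonglongrightarrow> a - a"
    by (intro tendsto_diff filterlim_compose[OF lim] filterlim_real_sequentially
        filterlim_at_top_mono[OF filterlim_real_sequentially]) auto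
  ultimately show ?thesis
    by (simp add: z(2) LIMSEQ_unique)
qed

text \<open>Near an attracting stationary point \<open>a\<close> the vector field is \<open>E k * (k - a)\<close> with \<open>E\<close> negative,
  and trajectories decay at rates between the bounds of \<open>E\<close>. Bounds on both sides of \<open>a\<close> are
  needed even for a start at or above \<open>a\<close>: levels below \<open>a\<close> are the barriers that keep the
  trajectory from falling below \<open>a\<close>.\<close>

lemma trajectory_exponential_bounds:
  fixes y E :: "real \<Rightarrow> real"
  assumes y: "\<And>s. s \<ge> 0 \<Longrightarrow> (y has_real_derivative E (y s) * (y s - a)) (at s within {0..})"
    and E: "\<And>k. \<bar>k - a\<bar> < d \<Longrightarrow> A \<le> E k \<and> E k \<le> B" and B: "B < 0"
    and y0: "a \<le> y 0" "y 0 < a + d" and t: "t \<ge> 0"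
  shows "a \<le> y t" and "(y 0 - a) * exp (A * t) \<le> y t - a"
    and "y t - a \<le> (y 0 - a) * exp (B * t)" and "y t \<le> y 0"
proof -
  have neg: "E p * (p - a) < 0" if "a < p" "p < a + d" for p
    using E[of p] B that by (intro mult_neg_pos) auto
  have pos: "0 < E p * (p - a)" if "p < a" "a - d < p" for p
    using E[of p] B that by (intro mult_neg_neg) auto
  have lower: "a \<le> y s" if s: "s \<ge> 0" for s
  proof (rule dense_le_bounded[of "a - d"])
    show "p \<le> y s" if "a - d < p" "p < a" for p
      by (rule trajectory_stays_above[OF y _ pos s]) (use that y0 in auto)
  qed (use y0 in auto)
  have upper: "y s \<le> y 0" if s: "s \<ge> 0" for s
  proof (rule dense_ge_bounded[of _ "a + d"])
    show "y s \<le> p" if "y 0 < p" "p < a + d" for p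
      by (rule trajectory_stays_below[OF y _ neg s]) (use that y0 in auto)
  qed (use y0 in auto)
  have near: "A \<le> E (y s)" "E (y s) \<le> B" if "s \<ge> 0" for s
    using E[of "y s"] lower[OF that] upper[OF that] y0 by auto
  have der: "((\<lambda>s. (y s - a) * exp (- c * s)) has_real_derivative
      (E (y s) - c) * (y s - a) * exp (- c * s)) (at s within {0..})" if "s \<ge> 0" for s c
    by (rule derivative_eq_intros y refl that)+ (simp add: algebra_simps)
  show "a \<le> y t" "y t \<le> y 0" using lower upper t by auto
  have "(y 0 - a) * exp (A * t) \<le> y t - a \<and> y t - a \<le> (y 0 - a) * exp (B * t)"
  proof (cases "t = 0")
    case False
    then have t': "0 < t" using t by simp
    obtain z where z: "0 < z" "(y t - a) * exp (- A * t) - (y 0 - a) * exp (- A * 0) =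
        (E (y z) - A) * (y z - a) * exp (- A * z) * (t - 0)"
      using half_line_mvt[OF der[of _ A] order_refl t'] by metis
    have "0 \<le> (E (y z) - A) * (y z - a) * exp (- A * z) * (t - 0)"
      using near[of z] lower[of z] z(1) t by simp
    then have "y 0 - a \<le> (y t - a) * exp (- A * t)" using z(2) by simp
    moreover obtain w where w: "0 < w" "(y t - a) * exp (- B * t) - (y 0 - a) * exp (- B * 0) =
        (E (y w) - B) * (y w - a) * exp (- B * w) * (t - 0)"
      using half_line_mvt[OF der[of _ B] order_refl t'] by metis
    have "(E (y w) - B) * (y w - a) * exp (- B * w) * (t - 0) \<le> 0"
      using near[of w] lower[of w] w(1) t
      by (intro mult_nonpos_nonneg) auto
    then have "(y t - a) * exp (- B * t) \<le> y 0 - a" using w(2) by simp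
    ultimately show ?thesis
      by (simp add: exp_minus field_simps)
  qed auto
  then show "(y 0 - a) * exp (A * t) \<le> y t - a" "y t - a \<le> (y 0 - a) * exp (B * t)"
    by auto
qed

lemma trajectory_linearization:
  fixes E :: "real \<Rightarrow> real" and K :: "real \<Rightarrow> real \<Rightarrow> real" and x :: "nat \<Rightarrow> real"
  assumes K: "\<And>n s. s \<ge> 0 \<Longrightarrow>
      ((\<lambda>t. K t (x n)) has_real_derivative E (K s (x n)) * (K s (x n) - a)) (at s within {0..})"
    and K0: "\<And>n. K 0 (x n) = x n"
    and E: "isCont E a" "E a < 0" and x: "\<And>n. a < x n" "x \<longlonglongrightarrow> a" and t: "t \<ge> 0"
  shows "(\<lambda>n. (K t (x n) - a) / (x n - a)) \<longlonglongrightarrow> exp (E a * t)"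
proof -
  have bounds: "\<forall>\<^sub>F n in sequentially. exp ((E a - e) * t) \<le> (K t (x n) - a) / (x n - a) \<and>
      (K t (x n) - a) / (x n - a) \<le> exp ((E a + e) * t)" if e: "0 < e" "e < - E a" for e
  proof -
    obtain d where d: "d > 0" "\<And>k. \<bar>k - a\<bar> < d \<Longrightarrow> \<bar>E k - E a\<bar> < e"
      using E(1) e(1) unfolding continuous_at_eps_delta dist_real_def by metis
    have "\<forall>\<^sub>F n in sequentially. x n < a + d"
      using order_tendstoD(2)[OF x(2)] d(1) by simp
    then show ?thesis
    proof eventually_elim
      case (elim n)
      have "E a - e \<le> E k \<and> E k \<le> E a + e" if "\<bar>k - a\<bar> < d" for k
        using d(2)[OF that] by linarith
      then have "(x n - a) * exp ((E a - e) * t) \<le> K t (x n) - a"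
          "K t (x n) - a \<le> (x n - a) * exp ((E a + e) * t)"
        using trajectory_exponential_bounds(2,3)[where y = "\<lambda>t. K t (x n)", OF K, of d "E a - e" "E a + e" t]
          x(1)[of n] elim K0 e t by auto
      then show ?case
        using x(1)[of n] by (simp add: field_simps)
    qed
  qed
  have small: "\<forall>\<^sub>F e in at_right 0. 0 < e \<and> e < - E a"
    using E(2) eventually_at_right_less by (auto intro: eventually_conj eventually_at_rightI)
  show ?thesis
  proof (rule order_tendstoI)
    fix c assume c: "c < exp (E a * t)"
    have "((\<lambda>e. exp ((E a - e) * t)) \<longlongrightarrow> exp ((E a - 0) * t)) (at_right 0)"
      by (intro tendsto_intros)
    then have "\<forall>\<^sub>F e in at_right 0. c < exp ((E a - e) * t)"
      using c by (intro order_tendstoD) auto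
    then obtain e where "c < exp ((E a - e) * t)" "0 < e" "e < - E a"
      using eventually_happens'[OF _ eventually_conj[OF _ small]] trivial_limit_at_right_real by blast
    then show "\<forall>\<^sub>F n in sequentially. c < (K t (x n) - a) / (x n - a)"
      using bounds[of e] by (auto elim: eventually_mono)
  next
    fix c assume c: "exp (E a * t) < c"
    have "((\<lambda>e. exp ((E a + e) * t)) \<longlongrightarrow> exp ((E a + 0) * t)) (at_right 0)"
      by (intro tendsto_intros)
    then have "\<forall>\<^sub>F e in at_right 0. exp ((E a + e) * t) < c"
      using c by (intro order_tendstoD) auto
    then obtain e where "exp ((E a + e) * t) < c" "0 < e" "e < - E a"
      using eventually_happens'[OF _ eventually_conj[OF _ small]] trivial_limit_at_right_real by blast
    then show "\<forall>\<^sub>F n in sequentially. (K t (x n) - a) / (x n - a) < c"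
      using bounds[of e] by (auto elim: eventually_mono)
  qed
qed

section \<open>Differentiating an integral along the flow\<close>

text \<open>The derivative at a stationary point \<open>a\<close> of the integral of \<open>w t * g (K t k)\<close> with respect
  to the initial value \<open>k\<close>. The weight \<open>w\<close> has to be integrable only against every decaying
  exponential, because \<open>g (K t k) - g a\<close> decays exponentially.\<close>

lemma flow_integral_right_derivative:
  fixes E g w :: "real \<Rightarrow> real" and K :: "real \<Rightarrow> real \<Rightarrow> real"
  assumes d0: "d0 > 0"
    and K: "\<And>k s. a \<le> k \<Longrightarrow> k < a + d0 \<Longrightarrow> s \<ge> 0 \<Longrightarrow>
      ((\<lambda>t. K t k) has_real_derivative E (K s k) * (K s k - a)) (at s within {0..})"
    and K0: "\<And>k. a \<le> k \<Longrightarrow> k < a + d0 \<Longrightarrow> K 0 k = k"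
    and E: "isCont E a" "E a < 0"
    and g: "(g has_real_derivative D) (at a)"
    and w: "\<And>m. m > 0 \<Longrightarrow> (\<lambda>t. \<bar>w t\<bar> * exp (- m * t)) integrable_on {0..}"
    and int: "\<And>k. a \<le> k \<Longrightarrow> k < a + d0 \<Longrightarrow> (\<lambda>t. w t * g (K t k)) integrable_on {0..}"
  shows "((\<lambda>k. (integral {0..} (\<lambda>t. w t * g (K t k)) - integral {0..} (\<lambda>t. w t * g (K t a))) / (k - a))
    \<longlongrightarrow> D * integral {0..} (\<lambda>t. w t * exp (E a * t))) (at_right a)"
proof -
  \<comment> \<open>half of the linear rate, which dominates uniformly in the initial values near \<open>a\<close>\<close>
  define B where "B = E a / 2"
  have B: "B < 0" using E(2) by (simp add: B_def)
  obtain H where H: "\<And>z. g z - g a = H z * (z - a)" "isCont H a" "H a = D"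
    using g unfolding CARAT_DERIV by blast
  obtain d1 where d1: "d1 > 0" "\<And>k. \<bar>k - a\<bar> < d1 \<Longrightarrow> \<bar>E k - E a\<bar> < - B"
    using E(1) B unfolding continuous_at_eps_delta dist_real_def by (metis neg_0_less_iff_less)
  obtain d2 where d2: "d2 > 0" "\<And>k. \<bar>k - a\<bar> < d2 \<Longrightarrow> \<bar>H k - D\<bar> < 1"
    using H(2,3) zero_less_one unfolding continuous_at_eps_delta dist_real_def by metis
  define d where "d = min d0 (min d1 d2)"
  have d: "d > 0" "d \<le> d0" "d \<le> d1" "d \<le> d2" using d0 d1 d2 by (auto simp: d_def)
  have Ebd: "E a + B \<le> E k \<and> E k \<le> B" if "\<bar>k - a\<bar> < d" for k
    using d1(2)[of k] that d B_def by (simp add: field_simps abs_less_iff)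
  have bounds: "a \<le> K t k" "K t k - a \<le> (k - a) * exp (B * t)" "K t k \<le> k"
    if "a \<le> k" "k < a + d" "t \<ge> 0" for k t
    using trajectory_exponential_bounds(1,3,4)[where y = "\<lambda>t. K t k", OF K Ebd B _ _ that(3)]
      that d K0[of k] by auto
  have Ka: "K t a = a" if "t \<ge> 0" for t
    using bounds(1,3)[of a t] that d by simp
  show ?thesis
  proof (rule tendsto_at_right_sequentially[of a "a + d"])
    fix S :: "nat \<Rightarrow> real"
    assume S: "\<And>n. a < S n" "\<And>n. S n < a + d" "S \<longlonglongrightarrow> a"
    define R where "R n t = (K t (S n) - a) / (S n - a)" for n t
    have Sk: "a \<le> S n" "S n < a + d0" for n
      using S(1,2)[of n] d by auto
    have R: "0 \<le> R n t" "R n t \<le> exp (B * t)" if "t \<ge> 0" for n t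
      using bounds(1,2)[of "S n" t] S(1,2)[of n] that by (auto simp: R_def field_simps)
    have limR: "(\<lambda>n. R n t) \<longlonglongrightarrow> exp (E a * t)" if t: "t \<ge> 0" for t
      unfolding R_def by (rule trajectory_linearization) (use K[OF Sk] K0[OF Sk] E S t in auto)
    define q where "q n t = w t * (H (K t (S n)) * R n t)" for n t
    have q_eq: "q n t = (w t * g (K t (S n)) - w t * g (K t a)) / (S n - a)" if t: "t \<ge> 0" for n t
    proof -
      have "w t * g (K t (S n)) - w t * g (K t a) = w t * (H (K t (S n)) * (K t (S n) - a))"
        by (simp add: Ka[OF t] flip: H(1) right_diff_distrib)
      then show ?thesis by (simp add: q_def R_def)
    qed
    have int_q: "((\<lambda>t. q n t) has_integral (integral {0..} (\<lambda>t. w t * g (K t (S n)))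
        - integral {0..} (\<lambda>t. w t * g (K t a))) / (S n - a)) {0..}" for n
    proof (rule has_integral_eq)
      show "((\<lambda>t. (w t * g (K t (S n)) - w t * g (K t a)) / (S n - a)) has_integral
          (integral {0..} (\<lambda>t. w t * g (K t (S n))) - integral {0..} (\<lambda>t. w t * g (K t a))) / (S n - a)) {0..}"
        by (intro has_integral_divide has_integral_diff integrable_integral int Sk) (use d0 in auto)
    qed (simp add: q_eq)
    have dom: "(\<lambda>t. (\<bar>w t\<bar> * exp (- (- B) * t)) * (\<bar>D\<bar> + 1)) integrable_on {0..}"
      by (rule integrable_on_mult_left[OF w]) (use B in simp)
    have le: "norm (q n t) \<le> (\<bar>w t\<bar> * exp (- (- B) * t)) * (\<bar>D\<bar> + 1)" if "t \<in> {0..}" for n t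
    proof -
      have t: "t \<ge> 0" using that by simp
      have "\<bar>K t (S n) - a\<bar> < d"
        using bounds(1,3)[of "S n" t] S(1,2)[of n] t by auto
      then have "\<bar>H (K t (S n))\<bar> \<le> \<bar>D\<bar> + 1"
        using d2(2)[of "K t (S n)"] d by linarith
      then have "\<bar>H (K t (S n))\<bar> * R n t \<le> (\<bar>D\<bar> + 1) * exp (B * t)"
        using R[OF t] by (intro mult_mono) auto
      then have "\<bar>w t\<bar> * (\<bar>H (K t (S n))\<bar> * R n t) \<le> \<bar>w t\<bar> * ((\<bar>D\<bar> + 1) * exp (B * t))"
        by (rule mult_left_mono) simp
      then show ?thesis
        using R(1)[OF t] by (simp add: q_def abs_mult ac_simps)
    qed
    have lim: "(\<lambda>n. q n t) \<longlonglongrightarrow> w t * (D * exp (E a * t))" if "t \<in> {0..}" for t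
    proof -
      have t: "t \<ge> 0" using that by simp
      have "(\<lambda>n. R n t * (S n - a) + a) \<longlonglongrightarrow> exp (E a * t) * (a - a) + a"
        by (intro tendsto_intros limR t S)
      moreover have "R n t * (S n - a) + a = K t (S n)" for n
        using S(1)[of n] by (simp add: R_def)
      ultimately have "(\<lambda>n. H (K t (S n))) \<longlonglongrightarrow> H a"
        by (intro isCont_tendsto_compose[OF H(2)]) simp
      then show ?thesis
        unfolding q_def H(3) by (intro tendsto_intros limR t)
    qed
    have "(\<lambda>n. integral {0..} (q n)) \<longlonglongrightarrow> integral {0..} (\<lambda>t. w t * (D * exp (E a * t)))"
      by (rule dominated_convergence(2)[OF _ dom le lim]) (use int_q in auto)
    moreover have "integral {0..} (\<lambda>t. w t * (D * exp (E a * t))) = D * integral {0..} (\<lambda>t. w t * exp (E a * t))"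
      by (simp flip: integral_mult_right add: ac_simps)
    ultimately show "(\<lambda>n. (integral {0..} (\<lambda>t. w t * g (K t (S n))) - integral {0..} (\<lambda>t. w t * g (K t a)))
        / (S n - a)) \<longlonglongrightarrow> D * integral {0..} (\<lambda>t. w t * exp (E a * t))"
      by (simp add: integral_unique[OF int_q])
  qed (use d in auto)
qed

section \<open>Exponential integrals of the discount function\<close>

lemma discount_function_has_derivative:
  assumes h: "discount_function h" and t: "t \<ge> 0"
  shows "(h has_real_derivative discount_deriv h t) (at t within {0..})"
  using h t unfolding discount_function_def discount_deriv_def
  by (auto simp: has_real_derivative_iff_has_vector_derivative vector_derivative_works)

lemma discount_function_le_1:
  assumes h: "discount_function h" and t: "t \<ge> 0"
  shows "h t \<le> 1"
proof (cases "t = 0")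
  case False
  obtain z where z: "0 < z" "h t - h 0 = discount_deriv h z * (t - 0)"
    by (rule half_line_mvt[OF discount_function_has_derivative[OF h], of 0 t]) (use False t in auto)
  then have "h t - h 0 \<le> 0"
    using h t unfolding discount_function_def by (simp add: mult_nonpos_nonneg)
  then show ?thesis using h by (simp add: discount_function_def)
qed (use h in \<open>simp add: discount_function_def\<close>)

lemma discount_function_continuous_on:
  "discount_function h \<Longrightarrow> continuous_on {0..} h"
  by (rule DERIV_continuous_on[of _ _ "discount_deriv h"]) (simp add: discount_function_has_derivative)

text \<open>The integrand is the derivative of \<open>h t * exp (r * t)\<close>, and it has a constant sign, so that it
  is integrable without further assumptions. For \<open>r = 0\<close> this integrates \<open>discount_deriv h\<close> itself.\<close>

lemma discount_exp_derivative_integral: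
  assumes h: "discount_function h" and r: "r \<le> 0"
  shows "((\<lambda>t. discount_deriv h t * exp (r * t) + r * (h t * exp (r * t))) has_integral -1) {0..}"
proof -
  define p where "p t = discount_deriv h t * exp (r * t) + r * (h t * exp (r * t))" for t
  have h': "continuous_on {0..} (discount_deriv h)" "h 0 = 1" "\<And>t. t \<ge> 0 \<Longrightarrow> h t \<ge> 0"
      "\<And>t. t \<ge> 0 \<Longrightarrow> discount_deriv h t \<le> 0" "(h \<longlongrightarrow> 0) at_top"
    using h by (auto simp: discount_function_def)
  have der: "((\<lambda>t. h t * exp (r * t)) has_real_derivative p t) (at t within {0..})" if "t \<ge> 0" for t
    unfolding p_def
    by (rule derivative_eq_intros discount_function_has_derivative[OF h that] refl)+ (simp add: algebra_simps)
  have fin: "(p has_integral h y * exp (r * y) - 1) {0..y}" if "y \<ge> 0" for y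
    using fundamental_theorem_of_calculus[OF that, of "\<lambda>t. h t * exp (r * t)" p]
      has_field_derivative_subset[OF der] h'(2)
    by (auto simp: has_real_derivative_iff_has_vector_derivative[symmetric])
  have "((\<lambda>t. - p t) has_integral 1) {0..}"
  proof (rule has_integral_to_inf)
    show "(\<lambda>t. - p t) integrable_on {0..y}" for y
      using fin[of y] by (cases "y \<ge> 0") (auto intro!: integrable_neg)
    have "((\<lambda>y. h y * exp (r * y)) \<longlongrightarrow> 0) at_top"
    proof (rule tendsto_sandwich[of "\<lambda>_. 0" _ _ h])
      show "\<forall>\<^sub>F y in at_top. 0 \<le> h y * exp (r * y)"
        using eventually_ge_at_top[of 0] by eventually_elim (simp add: h'(3))
      show "\<forall>\<^sub>F y in at_top. h y * exp (r * y) \<le> h y"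
        using eventually_ge_at_top[of 0]
        by eventually_elim (use r in \<open>simp add: h'(3) mult_left_le mult_nonpos_nonneg\<close>)
    qed (use h'(5) in auto)
    then have "((\<lambda>y. 1 - h y * exp (r * y)) \<longlongrightarrow> 1 - 0) at_top"
      by (intro tendsto_intros)
    moreover have "\<forall>\<^sub>F y in at_top. 1 - h y * exp (r * y) = integral {0..y} (\<lambda>t. - p t)"
      using eventually_ge_at_top[of 0]
      by eventually_elim (simp add: integral_unique[OF fin])
    ultimately show "((\<lambda>y. integral {0..y} (\<lambda>t. - p t)) \<longlongrightarrow> 1) at_top"
      by (simp add: tendsto_cong)
    show "- p y \<ge> 0" if "y \<ge> 0" for y
    proof -
      have "discount_deriv h y * exp (r * y) \<le> 0" "r * (h y * exp (r * y)) \<le> 0"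
        using h'(3,4)[OF that] r by (auto intro: mult_nonpos_nonneg)
      then show ?thesis by (simp add: p_def)
    qed
  qed
  then have "((\<lambda>t. - (- p t)) has_integral - 1) {0..}" by (rule has_integral_neg)
  then show ?thesis unfolding p_def minus_minus .
qed

lemma discount_function_exp_integrable:
  assumes h: "discount_function h" and m: "m > 0"
  shows "(\<lambda>t. h t * exp (- m * t)) integrable_on {0..}"
proof (rule measurable_bounded_by_integrable_imp_integrable)
  show "(\<lambda>t. h t * exp (- m * t)) \<in> borel_measurable (lebesgue_on {0..})"
    by (intro continuous_imp_measurable_on_sets_lebesgue continuous_intros
        discount_function_continuous_on h) auto
  show "(\<lambda>t. exp (- m * t)) integrable_on {0..}"
    by (rule integrable_on_exp_minus_to_infinity[OF m])
  show "norm (h t * exp (- m * t)) \<le> exp (- m * t)" if "t \<in> {0..}" for t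
    using discount_function_le_1[OF h, of t] h that
    by (simp add: discount_function_def mult_left_le_one_le)
qed auto

lemma discount_deriv_exp_integrable:
  assumes h: "discount_function h" and m: "m > 0"
  shows "(\<lambda>t. discount_deriv h t * exp (- m * t)) integrable_on {0..}"
proof -
  have "(\<lambda>t. (discount_deriv h t * exp (- m * t) + - m * (h t * exp (- m * t)))
      - - m * (h t * exp (- m * t))) integrable_on {0..}"
    using discount_exp_derivative_integral[OF h, of "- m"] m
    by (intro integrable_diff integrable_on_mult_right discount_function_exp_integrable[OF h m])
      (auto dest: has_integral_integrable)
  then show ?thesis by simp
qed

section \<open>Production, utility and strategy\<close>

lemma C1_differentiable_on_has_real_derivative:
  fixes g :: "real \<Rightarrow> real"
  assumes "g C1_differentiable_on S" "x \<in> S"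
  shows "(g has_real_derivative deriv g x) (at x)"
  using assms by (simp add: C1_differentiable_on_eq DERIV_deriv_iff_real_differentiable)

lemma strictly_concave_below_tangent:
  fixes g :: "real \<Rightarrow> real"
  assumes g: "strictly_concave_on S g" "open S" and xy: "x \<in> S" "y \<in> S" "x \<noteq> y"
    and D: "(g has_real_derivative D) (at x)"
  shows "g y - g x < D * (y - x)"
proof -
  have S: "convex S" using g by (simp add: strictly_concave_on_def)
  have strict: "(1 - t) * g p + t * g q < g ((1 - t) * p + t * q)"
    if "p \<in> S" "q \<in> S" "p \<noteq> q" "0 < t" "t < 1" for p q t
    using g that unfolding strictly_concave_on_def by blast
  have conv: "convex_on S (\<lambda>z. - g z)"
  proof (rule convex_onI)
    fix t p q :: real assume t: "0 < t" "t < 1" "p \<in> S" "q \<in> S"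
    show "- g ((1 - t) *\<^sub>R p + t *\<^sub>R q) \<le> (1 - t) * - g p + t * - g q"
      using strict[of p q t] t by (cases "p = q") (auto simp: algebra_simps)
  qed (use S in auto)
  have tangent: "g z - g x \<le> D * (z - x)" if z: "z \<in> S" for z
  proof -
    have "((\<lambda>z. - g z) has_real_derivative - D) (at x within S)"
      using has_field_derivative_at_within[OF DERIV_minus[OF D]] .
    moreover have "x \<in> interior S" using g xy by (simp add: interior_open)
    ultimately have "- g z - - g x \<ge> - D * (z - x)"
      by (rule convex_on_imp_above_tangent[OF conv convex_connected[OF S] _ z, rotated])
    then show ?thesis by simp
  qed
  \<comment> \<open>strictness at the midpoint gives strictness at \<open>y\<close>\<close>
  define z where "z = (1 - 1 / 2) * x + (1 / 2) * y"
  have "(1 - 1 / 2) *\<^sub>R x + (1 / 2) *\<^sub>R y \<in> S"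
    by (rule convexD_alt[OF S]) (use xy in auto)
  then have "z \<in> S" by (simp add: z_def)
  from tangent[OF this] strict[of x y "1 / 2"] xy
  show ?thesis by (simp add: z_def field_simps)
qed

lemma production_function_deriv_pos:
  assumes f: "production_function f" and k: "k > 0"
  shows "deriv f k > 0"
proof -
  have D: "(f has_real_derivative deriv f x) (at x)" if "x > 0" for x
    using f that by (auto simp: production_function_def C2_on_def
        intro: C1_differentiable_on_has_real_derivative)
  have anti: "deriv f y < deriv f x" if "0 < x" "x < y" for x y
  proof -
    have sc: "strictly_concave_on {0<..} f" using f by (simp add: production_function_def)
    have "f y - f x < deriv f x * (y - x)" "f x - f y < deriv f y * (x - y)"
      using that by (intro strictly_concave_below_tangent[OF sc] D; simp)+
    then have "0 < (deriv f x - deriv f y) * (y - x)" by (simp add: algebra_simps)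
    then show ?thesis using that by (simp add: zero_less_mult_iff)
  qed
  have "deriv f (k + 1) \<ge> 0"
  proof (rule tendsto_upperbound)
    show "(deriv f \<longlongrightarrow> 0) at_top" using f by (simp add: production_function_def)
    show "\<forall>\<^sub>F x in at_top. deriv f x \<le> deriv f (k + 1)"
      using eventually_gt_at_top[of "k + 1"]
      by eventually_elim (use anti k in \<open>auto intro: less_imp_le\<close>)
  qed simp
  then show ?thesis using anti[of k "k + 1"] k by simp
qed

text \<open>Differentiating \<open>i (deriv u c) = c\<close> also shows that \<open>deriv (deriv u)\<close> does not vanish, so that
  the quotient below is a genuine one.\<close>

lemma utility_inverse_has_derivative:
  assumes U: "utility_function C u i" and x: "x \<in> deriv u ` C"
  shows "(u has_real_derivative x) (at (i x))"
    and "(i has_real_derivative 1 / deriv (deriv u) (i x)) (at x)"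
proof -
  have iff: "deriv u c = y \<longleftrightarrow> c = i y" if "c \<in> C" "y \<in> deriv u ` C" for c y
    using U that unfolding utility_function_def by blast
  have C: "i x \<in> C" by (rule utility_conjugate_eq(1)[OF U x])
  have ux: "deriv u (i x) = x" using iff[OF C x] by simp
  have C2: "open C" "u C1_differentiable_on C" "deriv u C1_differentiable_on C"
      "i C1_differentiable_on (deriv u ` C)"
    using U by (auto simp: utility_function_def C2_on_def)
  show "(u has_real_derivative x) (at (i x))"
    using C1_differentiable_on_has_real_derivative[OF C2(2) C] ux by simp
  have i: "(i has_real_derivative deriv i x) (at x)"
    by (rule C1_differentiable_on_has_real_derivative[OF C2(4) x])
  have "((\<lambda>c. i (deriv u c)) has_real_derivative deriv i x * deriv (deriv u) (i x)) (at (i x))"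
    using DERIV_chain2[of i "deriv i x" "deriv u" "i x"] i ux
      C1_differentiable_on_has_real_derivative[OF C2(3) C] by simp
  moreover have "((\<lambda>c. i (deriv u c)) has_real_derivative 1) (at (i x))"
  proof (rule has_field_derivative_transform_within_open[OF DERIV_ident C2(1) C])
    show "c = i (deriv u c)" if "c \<in> C" for c using iff[of c "deriv u c"] that by simp
  qed
  ultimately have one: "deriv i x * deriv (deriv u) (i x) = 1" by (rule DERIV_unique)
  then have "deriv i x = 1 / deriv (deriv u) (i x)"
    by (cases "deriv (deriv u) (i x) = 0") (auto simp: field_simps)
  then show "(i has_real_derivative 1 / deriv (deriv u) (i x)) (at x)" using i by simp
qed

lemma strategy_has_derivative:
  assumes U: "utility_function C u i" and V: "C2_on \<Omega> V" "deriv V ` \<Omega> \<subseteq> deriv u ` C"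
    and k: "k \<in> \<Omega>"
  shows "(strategy i V has_real_derivative
      deriv (deriv V) k / deriv (deriv u) (strategy i V k)) (at k)"
    and "(u has_real_derivative deriv V k) (at (strategy i V k))"
proof -
  have x: "deriv V k \<in> deriv u ` C" using V(2) k by auto
  have "(deriv V has_real_derivative deriv (deriv V) k) (at k)"
    using V k by (auto simp: C2_on_def intro: C1_differentiable_on_has_real_derivative)
  from DERIV_chain2[OF utility_inverse_has_derivative(2)[OF U x] this]
  show "(strategy i V has_real_derivative
      deriv (deriv V) k / deriv (deriv u) (strategy i V k)) (at k)"
    by (simp add: strategy_def[abs_def])
  show "(u has_real_derivative deriv V k) (at (strategy i V k))"
    using utility_inverse_has_derivative(1)[OF U x] by (simp add: strategy_def)
qed

section \<open>The equilibrium rate\<close>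

theorem theorem9:
  fixes h u i f V :: "real \<Rightarrow> real" and C \<Omega> :: "real set" and kbar cbar \<alpha> :: real
  assumes "discount_function h"
    and "utility_function C u i"
    and "production_function f"
    and "equilibrium_point h C u i f \<Omega> V kbar"
    and "\<exists>N. kbar \<in> N \<and> C2_on N V"
    and "cbar = f kbar"
    and "\<alpha> = deriv (deriv V) kbar / deriv (deriv u) cbar"
  shows "\<alpha> \<ge> deriv f kbar \<and> deriv f kbar > 0 \<and>
    (\<alpha> > deriv f kbar \<longrightarrow> deriv u cbar \<noteq> 0 \<longrightarrow>
       \<alpha> * integral {0..} (\<lambda>t. h t * exp ((deriv f kbar - \<alpha>) * t)) = 1)"
proof -
  define \<sigma> where "\<sigma> = strategy i V"
  define g where "g k = u (\<sigma> k)" for k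
  note h = assms(1) and U = assms(2) and P = assms(3)
  have kb: "kbar \<in> \<Omega>" and conv: "\<And>k0 k. k0 \<in> \<Omega> \<Longrightarrow> trajectory f \<sigma> \<Omega> k0 k \<Longrightarrow> (k \<longlongrightarrow> kbar) at_top"
    and \<Omega>: "\<Omega> \<subseteq> {0<..}" "C2_on \<Omega> V" "deriv V ` \<Omega> \<subseteq> deriv u ` C"
    using assms(4) by (auto simp: equilibrium_point_def stationary_equilibrium_def \<sigma>_def)
  obtain K where K: "\<And>k. k \<in> \<Omega> \<Longrightarrow> trajectory f \<sigma> \<Omega> k (\<lambda>t. K t k)"
    and eq: "(\<forall>k\<in>\<Omega>. integral_equation h u i V K k) \<or> (\<forall>k\<in>\<Omega>. differentiated_equation h C u i f V K k)"
    using assms(4) unfolding equilibrium_point_def stationary_equilibrium_def \<sigma>_def by blast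
  have openO: "open \<Omega>" using \<Omega>(2) by (simp add: C2_on_def)
  have K0: "K 0 k = k"
    and Kd: "t \<ge> 0 \<Longrightarrow> ((\<lambda>t. K t k) has_real_derivative f (K t k) - \<sigma> (K t k)) (at t within {0..})"
    if "k \<in> \<Omega>" for k t
    using K[OF that] by (auto simp: trajectory_def)
  have Klim: "((\<lambda>t. K t k) \<longlongrightarrow> kbar) at_top" if "k \<in> \<Omega>" for k
    using conv[OF that K[OF that]] .
  obtain d0 where d0: "d0 > 0" "ball kbar d0 \<subseteq> \<Omega>"
    using openO kb unfolding open_contains_ball by blast
  have near: "k \<in> \<Omega>" if "kbar \<le> k" "k < kbar + d0" for k
    using d0(2) that by (auto simp: subset_iff dist_real_def)

  have Vd: "(V has_real_derivative deriv V k) (at k)"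
      "(deriv V has_real_derivative deriv (deriv V) k) (at k)" if "k \<in> \<Omega>" for k
    using \<Omega>(2) that by (auto simp: C2_on_def intro: C1_differentiable_on_has_real_derivative)
  have fd: "(f has_real_derivative deriv f kbar) (at kbar)"
    using P kb \<Omega>(1) by (auto simp: production_function_def C2_on_def
        intro!: C1_differentiable_on_has_real_derivative)
  note \<sigma>' = strategy_has_derivative[OF U \<Omega>(2,3) kb, folded \<sigma>_def]
  have "isCont f kbar" "isCont \<sigma> kbar"
    using fd \<sigma>'(1) by (auto intro: DERIV_isCont)
  then have "f kbar - \<sigma> kbar = 0"
    by (intro limit_of_trajectory_is_stationary[OF Kd[OF kb] Klim[OF kb]]) (auto intro: continuous_intros)
  then have \<sigma>_kb: "\<sigma> kbar = cbar" using assms(6) by simp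
  have \<sigma>d: "(\<sigma> has_real_derivative \<alpha>) (at kbar)" using \<sigma>'(1) assms(7) \<sigma>_kb by simp
  have ud: "(u has_real_derivative deriv V kbar) (at cbar)" using \<sigma>'(2) \<sigma>_kb by simp
  then have uc: "deriv u cbar = deriv V kbar" by (rule DERIV_imp_deriv)
  have gd: "(g has_real_derivative deriv V kbar * \<alpha>) (at kbar)"
    unfolding g_def[abs_def] using DERIV_chain2[OF _ \<sigma>d, of u] ud \<sigma>_kb by simp
  obtain E where E: "\<And>k. f k - \<sigma> k = E k * (k - kbar)" "isCont E kbar" "E kbar = deriv f kbar - \<alpha>"
    using DERIV_diff[OF fd \<sigma>d] \<sigma>_kb assms(6) unfolding CARAT_DERIV by auto

  \<comment> \<open>if \<open>f - \<sigma>\<close> increased at \<open>kbar\<close>, it would be positive just above \<open>kbar\<close> and trajectories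
    from there could not come back\<close>
  have stable: "E kbar \<le> 0"
  proof (rule ccontr)
    assume "\<not> E kbar \<le> 0"
    then have "\<forall>\<^sub>F k in at kbar. 0 < E k"
      using E(2) by (intro order_tendstoD[of E "E kbar"]) (auto simp: isCont_def)
    then obtain e where e: "e > 0" "\<And>k. k \<noteq> kbar \<Longrightarrow> dist k kbar < e \<Longrightarrow> 0 < E k"
      unfolding eventually_at by auto
    define p where "p = kbar + min d0 e / 2"
    have p: "kbar < p" "p < kbar + d0" "dist p kbar < e"
      using d0(1) e(1) by (auto simp: p_def dist_real_def)
    then have pO: "p \<in> \<Omega>" using near by auto
    have "0 < f p - \<sigma> p" using e(2)[of p] p E(1)[of p] by simp
    then have "p \<le> K t p" if "t \<ge> 0" for t
      using trajectory_stays_above[where G = "\<lambda>k. f k - \<sigma> k" and y = "\<lambda>t. K t p", OF Kd[OF pO]]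
        that K0[OF pO] by simp
    then have "\<forall>\<^sub>F t in at_top. p \<le> K t p"
      by (rule eventually_at_top_linorderI)
    then have "p \<le> kbar" by (intro tendsto_lowerbound[OF Klim[OF pO]]) auto
    then show False using p by simp
  qed

  have "\<alpha> * integral {0..} (\<lambda>t. h t * exp ((deriv f kbar - \<alpha>) * t)) = 1"
    if \<alpha>: "\<alpha> > deriv f kbar" and nz: "deriv u cbar \<noteq> 0"
  proof -
    define r where "r = deriv f kbar - \<alpha>"
    define I where "I = integral {0..} (\<lambda>t. h t * exp (r * t))"
    have r: "r < 0" "E kbar = r" using \<alpha> E(3) by (auto simp: r_def)
    have linear: "((\<lambda>k. (integral {0..} (\<lambda>t. w t * g (K t k)) - integral {0..} (\<lambda>t. w t * g (K t kbar))) / (k - kbar))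
        \<longlongrightarrow> deriv V kbar * \<alpha> * integral {0..} (\<lambda>t. w t * exp (r * t))) (at_right kbar)"
      if "\<And>m. m > 0 \<Longrightarrow> (\<lambda>t. \<bar>w t\<bar> * exp (- m * t)) integrable_on {0..}"
        "\<And>k. k \<in> \<Omega> \<Longrightarrow> (\<lambda>t. w t * g (K t k)) integrable_on {0..}" for w
      unfolding r(2)[symmetric]
      by (rule flow_integral_right_derivative[OF d0(1) _ _ E(2) _ gd that(1)])
        (use Kd E(1) K0 near r that(2) in auto)
    have "\<alpha> * I = 1"
      using eq
    proof
      assume "\<forall>k\<in>\<Omega>. integral_equation h u i V K k"
      then have int: "(\<lambda>t. h t * g (K t k)) integrable_on {0..}"
        and Veq: "V k = integral {0..} (\<lambda>t. h t * g (K t k))" if "k \<in> \<Omega>" for k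
        using that by (auto simp: integral_equation_def g_def \<sigma>_def strategy_def)
      have "(\<lambda>t. \<bar>h t\<bar> * exp (- m * t)) integrable_on {0..}" if "m > 0" for m
        by (rule integrable_eq[OF discount_function_exp_integrable[OF h that]])
          (use h in \<open>simp add: discount_function_def\<close>)
      from linear[OF this int]
      have "((\<lambda>k. (V k - V kbar) / (k - kbar)) \<longlongrightarrow> deriv V kbar * \<alpha> * I) (at_right kbar)"
        unfolding I_def
      proof (rule Lim_transform_within[OF _ d0(1)])
        show "(integral {0..} (\<lambda>t. h t * g (K t k)) - integral {0..} (\<lambda>t. h t * g (K t kbar))) / (k - kbar)
            = (V k - V kbar) / (k - kbar)" if "k \<in> {kbar<..}" "dist k kbar < d0" for k
          using Veq[of k] Veq[OF kb] near[of k] that by (simp add: dist_real_def)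
      qed
      moreover have "((\<lambda>k. (V k - V kbar) / (k - kbar)) \<longlongrightarrow> deriv V kbar) (at_right kbar)"
        using has_field_derivative_at_within[OF Vd(1)[OF kb]] by (simp add: has_field_derivative_iff)
      ultimately have "deriv V kbar = deriv V kbar * \<alpha> * I"
        by (intro tendsto_unique[OF trivial_limit_at_right_real])
      then show ?thesis using nz uc by simp
    next
      assume de: "\<forall>k\<in>\<Omega>. differentiated_equation h C u i f V K k"
      define J where "J = integral {0..} (\<lambda>t. discount_deriv h t * exp (r * t))"
      \<comment> \<open>on \<open>\<Omega>\<close>, the terms of the equation outside the integral, with the maximum in the conjugate
        attained at \<open>\<sigma> k\<close>\<close>
      define G where "G k = deriv V k * f k + (g k - deriv V k * \<sigma> k)" for k
      have conj: "utility_conjugate C u (deriv V k) = g k - deriv V k * \<sigma> k" if "k \<in> \<Omega>" for k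
        using utility_conjugate_eq(3)[OF U, of "deriv V k"] \<Omega>(3) that
        by (auto simp: g_def \<sigma>_def strategy_def)
      have int: "(\<lambda>t. discount_deriv h t * g (K t k)) integrable_on {0..}"
        and Geq: "G k = - integral {0..} (\<lambda>t. discount_deriv h t * g (K t k))" if "k \<in> \<Omega>" for k
      proof -
        have "(\<lambda>t. discount_deriv h t * g (K t k)) integrable_on {0..}"
          "deriv V k * f k + integral {0..} (\<lambda>t. discount_deriv h t * g (K t k))
            + utility_conjugate C u (deriv V k) = 0"
          using bspec[OF de that] by (auto simp: differentiated_equation_def g_def \<sigma>_def strategy_def)
        then show "(\<lambda>t. discount_deriv h t * g (K t k)) integrable_on {0..}"
            "G k = - integral {0..} (\<lambda>t. discount_deriv h t * g (K t k))"
          using conj[OF that] by (simp_all add: G_def)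
      qed
      have "(\<lambda>t. \<bar>discount_deriv h t\<bar> * exp (- m * t)) integrable_on {0..}" if "m > 0" for m
        by (rule integrable_eq[OF integrable_neg[OF discount_deriv_exp_integrable[OF h that]]])
          (use h in \<open>simp add: discount_function_def\<close>)
      from tendsto_minus[OF linear[OF this int]]
      have "((\<lambda>k. (G k - G kbar) / (k - kbar)) \<longlongrightarrow>
          - (deriv V kbar * \<alpha> * J)) (at_right kbar)"
        unfolding J_def
      proof (rule Lim_transform_within[OF _ d0(1)])
        show "- ((integral {0..} (\<lambda>t. discount_deriv h t * g (K t k))
            - integral {0..} (\<lambda>t. discount_deriv h t * g (K t kbar))) / (k - kbar))
            = (G k - G kbar) / (k - kbar)" if "k \<in> {kbar<..}" "dist k kbar < d0" for k
          using Geq[of k] Geq[OF kb] near[of k] that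
          by (simp add: dist_real_def minus_divide_left)
      qed
      \<comment> \<open>the terms with \<open>deriv (deriv V) kbar\<close> and \<open>\<alpha>\<close> cancel, as \<open>f kbar = \<sigma> kbar\<close>\<close>
      moreover have "(G has_real_derivative deriv V kbar * deriv f kbar) (at kbar)"
        unfolding G_def[abs_def]
        by (rule derivative_eq_intros Vd(2)[OF kb] fd gd \<sigma>d refl)+
          (use \<sigma>_kb assms(6) in \<open>simp add: algebra_simps\<close>)
      then have "((\<lambda>k. (G k - G kbar) / (k - kbar)) \<longlongrightarrow> deriv V kbar * deriv f kbar) (at_right kbar)"
        using has_field_derivative_at_within by (auto simp: has_field_derivative_iff)
      ultimately have "deriv V kbar * deriv f kbar = - (deriv V kbar * \<alpha> * J)"
        by (intro tendsto_unique[OF trivial_limit_at_right_real])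
      then have "deriv V kbar * deriv f kbar = deriv V kbar * - (\<alpha> * J)"
        by (simp add: mult.assoc)
      then have "deriv f kbar = - (\<alpha> * J)"
        using nz uc by (simp only: mult_left_cancel)
      moreover have "J = - 1 - r * I"
      proof -
        have "((\<lambda>t. discount_deriv h t * exp (r * t) + r * (h t * exp (r * t))) has_integral J + r * I) {0..}"
          unfolding I_def J_def
          using discount_deriv_exp_integrable[OF h, of "- r"] discount_function_exp_integrable[OF h, of "- r"] r
          by (intro has_integral_add has_integral_mult_right integrable_integral) auto
        from has_integral_unique[OF this discount_exp_derivative_integral[OF h]] r
        show ?thesis by simp
      qed
      ultimately have "deriv f kbar = \<alpha> + r * (\<alpha> * I)" by (simp add: algebra_simps)
      then have "r * (\<alpha> * I) = r * 1" using r_def by linarith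
      then show ?thesis using r by simp
    qed
    then show ?thesis by (simp add: I_def r_def)
  qed
  moreover have "deriv f kbar > 0"
    using production_function_deriv_pos[OF P] kb \<Omega>(1) by auto
  ultimately show ?thesis using stable E(3) by auto
qed

end
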